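(* Let $G$ be a $3$-edge-proper graph of order $n\geq 6$ with at least one edge. Then $|E(G)|\geq \left\lceil \frac{5n}{3}\right\rceil$.
   Context: All graphs are finite and simple; the order of a graph is its number of vertices. $C_i$ denotes a cycle with $i$ vertices. For an integer $k\ge 3$, a graph $G$ is called $k$-edge-proper if each edge of $G$ lies in a cycle $C_i$ of $G$ for every integer $i$ with $3\leq i\leq k$ and also lies in a Hamilton cycle of $G$. (So $3$-edge-proper means that every edge lies in a triangle and in a Hamilton cycle.) *)

theory Defs
  imports Complex_Main
begin

text \<open>A graph is given by its vertex set \<open>V\<close> and its set \<open>E\<close> of edges, an edge being an
  unordered pair of distinct vertices.\<close>

definition simple_graph :: "'a set \<Rightarrow> 'a set set \<Rightarrow> bool" where
  "simple_graph V E \<longleftrightarrow> finite V \<and> (\<forall>e\<in>E. e \<subseteq> V \<and> card e = 2)"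

text \<open>A cycle is represented by the list of its vertices in cyclic order, without repeating the
  first vertex at the end; its length is therefore the length of the list. The same
  cycle subgraph is represented by several lists (its rotations and reversals).\<close>

definition cycle_edges :: "'a list \<Rightarrow> 'a set set" where
  "cycle_edges c = {{c ! i, c ! (Suc i mod length c)} | i. i < length c}"

definition is_cycle :: "'a set \<Rightarrow> 'a set set \<Rightarrow> 'a list \<Rightarrow> bool" where
  "is_cycle V E c \<longleftrightarrow> length c \<ge> 3 \<and> distinct c \<and> set c \<subseteq> V \<and> cycle_edges c \<subseteq> E"

definition is_hamilton_cycle :: "'a set \<Rightarrow> 'a set set \<Rightarrow> 'a list \<Rightarrow> bool" where
  "is_hamilton_cycle V E c \<longleftrightarrow> is_cycle V E c \<and> set c = V"

text \<open>The notion is only intended for \<open>k \<ge> 3\<close>.\<close>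

definition edge_proper :: "nat \<Rightarrow> 'a set \<Rightarrow> 'a set set \<Rightarrow> bool" where
  "edge_proper k V E \<longleftrightarrow>
    (\<forall>e\<in>E. (\<forall>i\<in>{3..k}. \<exists>c. is_cycle V E c \<and> length c = i \<and> e \<in> cycle_edges c) \<and>
           (\<exists>c. is_hamilton_cycle V E c \<and> e \<in> cycle_edges c))"

end

theory Submission
  imports Defs
begin

text \<open>The bound says that the average degree is at least \<open>10/3\<close>, and it is proved by discharging.
  The Hamilton cycle through an edge \<open>pq\<close> visits all the other vertices along one path, so
  deleting both ends of an edge never disconnects the graph (\<open>edge_ends_do_not_separate\<close>). This is
  the only way in which Hamilton cycles enter, apart from showing that no vertex is isolated.
  Since every edge at a vertex of degree 2 would lie in one and the same triangle, the opposite
  edge of that triangle would separate the vertex from the rest; hence all degrees are at least 3.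

  At a vertex \<open>v\<close> of degree 3 the triangle condition forces a path \<open>a b c\<close> on the three
  neighbours. Playing triangles against the separation property in the possible configurations
  shows that \<open>v\<close> has either a neighbour of degree at least 5 or two neighbours of degree at least 4
  (\<open>cubic_vertex_receives\<close>). The configuration that has to be excluded with most care is the
  wheel with four spokes: it is 3-edge-proper, but it has five vertices and only 8 edges, which is
  less than \<open>25/3\<close>. This is why the order must be at least 6.

  Now give every vertex its degree as charge. Every vertex of degree 4 sends \<open>1/6\<close>, and every
  vertex of larger degree \<open>1/3\<close>, to each of its neighbours. Every vertex of degree at least 4 keeps
  at least \<open>10/3\<close>, and every vertex of degree 3 receives at least \<open>1/3\<close>.\<close>

section \<open>Triangles and Hamilton cycles\<close>

lemma edge_proper_3_triangle:
  assumes "edge_proper 3 V E" and "{u, v} \<in> E"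
  shows "\<exists>w. {u, w} \<in> E \<and> {v, w} \<in> E"
proof -
  obtain c where c: "is_cycle V E c" "length c = 3" "{u, v} \<in> cycle_edges c"
    using assms by (fastforce simp: edge_proper_def)
  obtain x y z where xyz: "c = [x, y, z]"
    using c(2) by (auto simp: numeral_3_eq_3 length_Suc_conv)
  have ce: "cycle_edges c = {{x, y}, {y, z}, {z, x}}"
  proof -
    have "cycle_edges c = (\<lambda>i. {c ! i, c ! (Suc i mod length c)}) ` {..<3}"
      using c(2) by (auto simp: cycle_edges_def)
    also have "{..<3} = {0, 1, 2::nat}"
      by auto
    finally show ?thesis
      by (simp add: xyz numeral_2_eq_2)
  qed
  then have "{{x, y}, {y, z}, {z, x}} \<subseteq> E"
    using c(1) by (simp add: is_cycle_def)
  then have "{x, y} \<in> E" "{y, x} \<in> E" "{y, z} \<in> E" "{z, y} \<in> E" "{z, x} \<in> E" "{x, z} \<in> E"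
    by (simp_all add: insert_commute)
  then show ?thesis
    using c(3) unfolding ce by (auto simp: doubleton_eq_iff)
qed

lemma hamilton_cycle_covers:
  assumes "is_hamilton_cycle V E c" and "v \<in> V"
  shows "\<exists>u. {v, u} \<in> E"
proof -
  obtain i where "i < length c" "c ! i = v"
    using assms by (auto simp: is_hamilton_cycle_def in_set_conv_nth)
  then have "{v, c ! (Suc i mod length c)} \<in> cycle_edges c"
    by (auto simp: cycle_edges_def)
  then show ?thesis
    using assms(1) by (auto simp: is_hamilton_cycle_def is_cycle_def)
qed

text \<open>Read from \<open>p\<close> or \<open>q\<close> onwards, a Hamilton cycle through \<open>pq\<close> traverses all remaining vertices
  consecutively; a set that no edge leaves, except towards \<open>p\<close> or \<open>q\<close>, is therefore never left
  and never entered along this path.\<close>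

lemma edge_ends_do_not_separate:
  assumes ham: "is_hamilton_cycle V E c" and e: "{p, q} \<in> cycle_edges c"
    and "S \<noteq> {}" and SV: "S \<subseteq> V - {p, q}"
    and closed: "\<And>s t. s \<in> S \<Longrightarrow> {s, t} \<in> E \<Longrightarrow> t \<in> S \<union> {p, q}"
  shows "V \<subseteq> S \<union> {p, q}"
proof -
  define n where "n = length c"
  have n3: "n \<ge> 3" and dist: "distinct c" and setc: "set c = V" and sub: "cycle_edges c \<subseteq> E"
    using ham by (auto simp: is_hamilton_cycle_def is_cycle_def n_def)
  obtain i where i: "i < n" "{p, q} = {c ! i, c ! (Suc i mod n)}"
    using e by (auto simp: cycle_edges_def n_def)
  define f where "f k = c ! ((i + k) mod n)" for k
  have pq: "{p, q} = {f 0, f 1}"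
    using i by (simp add: f_def)
  have edge: "{f k, f (Suc k)} \<in> E" for k
  proof -
    have "(i + Suc k) mod n = Suc ((i + k) mod n) mod n"
      by (simp add: mod_Suc_eq)
    moreover have "(i + k) mod n < n"
      using n3 by simp
    ultimately show ?thesis
      using sub by (auto simp: cycle_edges_def f_def n_def)
  qed
  have cover: "\<exists>k<n. f k = x" if "x \<in> V" for x
  proof -
    obtain j where j: "j < n" "c ! j = x"
      using \<open>x \<in> V\<close> setc by (auto simp: in_set_conv_nth n_def)
    have "(i + (j + n - i) mod n) mod n = (i + (j + n - i)) mod n"
      by (simp add: mod_add_right_eq)
    also have "\<dots> = j"
      using i(1) j(1) by simp
    finally have "f ((j + n - i) mod n) = x"
      using j(2) by (simp add: f_def)
    moreover have "(j + n - i) mod n < n"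
      using n3 by simp
    ultimately show ?thesis
      by blast
  qed
  have off: "f k \<notin> {p, q}" if "2 \<le> k" "k < n" for k
  proof -
    have "(i + k) mod n \<noteq> i" "(i + k) mod n \<noteq> Suc i mod n"
      using that i(1) by (auto simp: mod_if)
    moreover have "(i + k) mod n < n" "Suc i mod n < n"
      using n3 by simp_all
    ultimately show ?thesis
      using i dist by (auto simp: f_def n_def nth_eq_iff_index_eq)
  qed
  have step: "f k \<in> S \<longleftrightarrow> f (Suc k) \<in> S" if "2 \<le> k" "Suc k < n" for k
    using closed edge[of k] off[of k] off[of "Suc k"] that
    by (metis Un_iff insert_commute Suc_lessD le_SucI)
  have const: "f (2 + k) \<in> S \<longleftrightarrow> f 2 \<in> S" if "2 + k < n" for k
    using that by (induction k) (use step in auto)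
  have all: "f k \<in> S \<longleftrightarrow> f 2 \<in> S" if "2 \<le> k" "k < n" for k
    using const[of "k - 2"] that by (simp only: le_add_diff_inverse)
  have idx: "\<exists>k. 2 \<le> k \<and> k < n \<and> f k = x" if "x \<in> V - {p, q}" for x
  proof -
    obtain k where "k < n" "f k = x"
      using cover \<open>x \<in> V - {p, q}\<close> by blast
    then have "f k \<notin> {f 0, f 1}"
      using \<open>x \<in> V - {p, q}\<close> unfolding pq by simp
    then have "k \<noteq> 0" "k \<noteq> 1"
      by (metis insertCI)+
    then show ?thesis
      using \<open>k < n\<close> \<open>f k = x\<close> by (intro exI[of _ k]) auto
  qed
  have "f 2 \<in> S"
    using \<open>S \<noteq> {}\<close> SV idx all by blast
  then show ?thesis
    using idx all by blast
qed

section \<open>Degrees\<close>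

definition nbrs :: "'a set set \<Rightarrow> 'a \<Rightarrow> 'a set" where
  "nbrs E v = {u. {v, u} \<in> E}"

abbreviation degree :: "'a set set \<Rightarrow> 'a \<Rightarrow> nat" where
  "degree E v \<equiv> card (nbrs E v)"

lemma nbrs_sym: "u \<in> nbrs E v \<longleftrightarrow> v \<in> nbrs E u"
  by (simp add: nbrs_def insert_commute)

lemma nbrs_irrefl: "simple_graph V E \<Longrightarrow> v \<notin> nbrs E v"
  by (auto simp: nbrs_def simple_graph_def)

lemma nbrs_subset: "simple_graph V E \<Longrightarrow> nbrs E v \<subseteq> V"
  by (auto simp: nbrs_def simple_graph_def)

lemma finite_nbrs: "simple_graph V E \<Longrightarrow> finite (nbrs E v)"
  by (meson finite_subset nbrs_subset simple_graph_def)

lemma sum_degree_eq_twice_card_edges: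
  assumes "simple_graph V E"
  shows "(\<Sum>v\<in>V. degree E v) = 2 * card E"
proof -
  have finV: "finite V" and E: "\<And>e. e \<in> E \<Longrightarrow> e \<subseteq> V \<and> card e = 2"
    using assms by (auto simp: simple_graph_def)
  have finE: "finite E"
    using E by (intro finite_subset[OF _ finite_Pow_iff[THEN iffD2, OF finV]]) auto
  have "degree E v = card {e \<in> E. v \<in> e}" for v
  proof (intro bij_betw_same_card[of "\<lambda>u. {v, u}"] bij_betw_imageI)
    show "inj_on (\<lambda>u. {v, u}) (nbrs E v)"
      by (auto simp: inj_on_def doubleton_eq_iff)
    show "(\<lambda>u. {v, u}) ` nbrs E v = {e \<in> E. v \<in> e}"
    proof (intro equalityI subsetI)
      fix e assume "e \<in> {e \<in> E. v \<in> e}"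
      then have e: "e \<in> E" "v \<in> e" "card e = 2"
        using E by auto
      then obtain x y where "e = {x, y}"
        by (auto simp: card_2_iff)
      then obtain u where "e = {v, u}"
        using e(2) by auto
      then show "e \<in> (\<lambda>u. {v, u}) ` nbrs E v"
        using e(1) by (auto simp: nbrs_def)
    qed (auto simp: nbrs_def)
  qed
  then have "(\<Sum>v\<in>V. degree E v) = (\<Sum>v\<in>V. card {e \<in> E. v \<in> e})"
    by simp
  also have "\<dots> = 2 * card E"
  proof (rule sum_multicount[OF finV finE])
    show "\<forall>e\<in>E. card {v \<in> V. v \<in> e} = 2"
    proof
      fix e assume "e \<in> E"
      then have "{v \<in> V. v \<in> e} = e" "card e = 2"
        using E by auto
      then show "card {v \<in> V. v \<in> e} = 2"
        by simp
    qed
  qed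
  finally show ?thesis .
qed

section \<open>Vertices of small degree\<close>

locale edge_proper_graph =
  fixes V :: "'a set" and E :: "'a set set"
  assumes graph: "simple_graph V E"
    and order: "6 \<le> card V"
    and nonempty: "E \<noteq> {}"
    and proper: "edge_proper 3 V E"
begin

abbreviation N :: "'a \<Rightarrow> 'a set" where "N \<equiv> nbrs E"

lemmas N_irrefl [simp] = nbrs_irrefl[OF graph]
lemmas N_subset = nbrs_subset[OF graph]
lemmas N_finite [simp] = finite_nbrs[OF graph]

lemma triangle: "u \<in> N v \<Longrightarrow> \<exists>w. w \<in> N u \<and> w \<in> N v"
  using edge_proper_3_triangle[OF proper, of u v] by (auto simp: nbrs_def insert_commute)

lemma closed_off_by_edge:
  assumes "q \<in> N p" and "S \<noteq> {}" and "S \<subseteq> V - {p, q}"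
    and "\<And>s. s \<in> S \<Longrightarrow> N s \<subseteq> S \<union> {p, q}"
  shows "card V \<le> card S + 2"
proof -
  have "{p, q} \<in> E"
    using assms(1) by (simp add: nbrs_def)
  then obtain c where "is_hamilton_cycle V E c" "{p, q} \<in> cycle_edges c"
    using proper by (auto simp: edge_proper_def)
  then have "V \<subseteq> S \<union> {p, q}"
    by (rule edge_ends_do_not_separate) (use assms in \<open>auto simp: nbrs_def\<close>)
  moreover have "finite S"
    using assms(3) graph finite_subset by (auto simp: simple_graph_def)
  ultimately have "card V \<le> card (S \<union> {p, q})"
    by (intro card_mono) auto
  also have "\<dots> \<le> card S + card {p, q}"
    by (rule card_Un_le)
  also have "card {p, q} \<le> 2"
    by (simp add: card_insert_if)
  finally show ?thesis
    by simp
qed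

lemma degree_ge_3:
  assumes "v \<in> V"
  shows "3 \<le> degree E v"
proof (rule ccontr)
  assume "\<not> 3 \<le> degree E v"
  obtain c where "is_hamilton_cycle V E c"
    using nonempty proper by (auto simp: edge_proper_def)
  then obtain a where a: "a \<in> N v"
    using hamilton_cycle_covers[of V E c v] assms by (auto simp: nbrs_def)
  then obtain b where b: "b \<in> N a" "b \<in> N v"
    using triangle by blast
  have "a \<noteq> b"
    using b(1) by auto
  moreover have "card {a, b} \<le> degree E v"
    using a b by (intro card_mono) auto
  ultimately have "{a, b} = N v"
    using a b \<open>\<not> 3 \<le> degree E v\<close> by (intro card_seteq) auto
  then have "card V \<le> card {v} + 2"
    using assms a b by (intro closed_off_by_edge[OF b(1)]) auto
  then show False
    using order by simp
qed

text \<open>In a pair \<open>v\<close>, \<open>b\<close> of adjacent twins of degree 3, the two common neighbours cannot be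
  adjacent, since they separate the pair from the rest. So \<open>a\<close> has a neighbour outside the
  configuration, and the triangle on the edge to it provides a second one.\<close>

lemma nbr_of_cubic_twins:
  assumes v: "N v = {a, b, c}" and b: "N b = {v, a, c}" and "a \<noteq> b" "a \<noteq> c" "b \<noteq> c"
  shows "4 \<le> degree E a"
proof -
  have va: "v \<in> N a" "b \<in> N a" "v \<in> N b"
    using v b by (simp_all add: nbrs_sym[of v] nbrs_sym[of b E a])
  have inV: "a \<in> V" "b \<in> V" "c \<in> V" "v \<in> V"
    using v b N_subset[of v] N_subset[of b] by auto
  have ne: "v \<noteq> a" "v \<noteq> b" "v \<noteq> c"
    using v N_irrefl[of v] by auto
  have nac: "c \<notin> N a"
  proof
    assume "c \<in> N a"
    then have "card V \<le> card {v, b} + 2"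
      by (rule closed_off_by_edge) (use v b inV ne assms(3-5) in auto)
    then show False
      using order ne by simp
  qed
  have "\<not> N a \<subseteq> {v, b}"
  proof
    assume "N a \<subseteq> {v, b}"
    then have "degree E a \<le> card {v, b}"
      by (intro card_mono) auto
    then show False
      using degree_ge_3[OF inV(1)] ne by simp
  qed
  then obtain x where x: "x \<in> N a" "x \<noteq> v" "x \<noteq> b"
    by auto
  have xne: "x \<noteq> a" "x \<noteq> c"
    using x nac by auto
  obtain y where y: "y \<in> N x" "y \<in> N a"
    using triangle[OF x(1)] by auto
  have "x \<in> N y" "x \<notin> N v" "x \<notin> N b"
    using y(1) v b x xne nbrs_sym[of x E y] by auto
  then have "y \<noteq> v" "y \<noteq> b" "y \<noteq> x"
    by auto
  then have "card {v, b, x, y} = 4"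
    using x ne by auto
  moreover have "card {v, b, x, y} \<le> degree E a"
    using va x y by (intro card_mono) auto
  ultimately show ?thesis
    by simp
qed

text \<open>The vertices \<open>a\<close> and \<open>c\<close> are not adjacent, since otherwise the edge \<open>ab\<close> would separate \<open>v\<close>
  and \<open>c\<close> from the rest. Each of them thus has a third neighbour outside the configuration, which
  the triangle condition makes adjacent to \<open>b\<close>. When these neighbours differ, \<open>b\<close> already has degree 5;
  when they coincide, the five vertices form a wheel with hub \<open>b\<close>, and a hub of degree 4 would leave
  the common neighbour as the only way out.\<close>

lemma middle_nbr_of_cubic_path:
  assumes v: "N v = {a, b, c}" and "a \<noteq> b" "a \<noteq> c" "b \<noteq> c"
    and ab: "b \<in> N a" and bc: "b \<in> N c"
    and dega: "degree E a = 3" and degc: "degree E c = 3"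
  shows "5 \<le> degree E b"
proof -
  have va: "v \<in> N a" "v \<in> N b" "v \<in> N c" "a \<in> N b" "c \<in> N b"
    using v ab bc by (simp_all add: nbrs_sym[of v] nbrs_sym[of a E b] nbrs_sym[of c E b])
  have inV: "a \<in> V" "b \<in> V" "c \<in> V" "v \<in> V"
    using v va N_subset[of v] N_subset[of a] by auto
  have ne: "v \<noteq> a" "v \<noteq> b" "v \<noteq> c"
    using v N_irrefl[of v] by auto
  have third: "\<exists>x. N u = {v, b, x} \<and> x \<noteq> v \<and> x \<noteq> b \<and> x \<noteq> u"
    if u: "v \<in> N u" "b \<in> N u" "degree E u = 3" for u
  proof -
    have "card (N u - {v, b}) = 1"
      using u ne by (subst card_Diff_subset) auto
    then obtain x where "N u - {v, b} = {x}"
      by (auto simp: card_1_singleton_iff)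
    then show ?thesis
      using u N_irrefl[of u] by (intro exI[of _ x]) blast
  qed
  obtain x where x: "N a = {v, b, x}" "x \<noteq> v" "x \<noteq> b" "x \<noteq> a"
    using third[of a] va ab dega by blast
  obtain y where y: "N c = {v, b, y}" "y \<noteq> v" "y \<noteq> b" "y \<noteq> c"
    using third[of c] va bc degc by blast
  have nac: "c \<notin> N a"
  proof
    assume *: "c \<in> N a"
    then have "x = c" "y = a"
      using x y ne assms(2-4) nbrs_sym[of c E a] by auto
    then have "card V \<le> card {v, c} + 2"
      by (intro closed_off_by_edge[OF ab]) (use v x y inV ne assms(2-4) in auto)
    then show False
      using order ne by simp
  qed
  then have xy: "x \<noteq> c" "y \<noteq> a"
    using x y nbrs_sym[of c E a] by auto
  have outer: "x \<in> N b" if "N u = {v, b, x}" "u \<in> {a, c}" "x \<notin> {v, a, b, c}" for u x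
  proof -
    obtain w where w: "w \<in> N x" "w \<in> N u"
      using triangle[of x u] \<open>N u = {v, b, x}\<close> by auto
    have "w \<noteq> v"
      using w v that(3) nbrs_sym[of v E x] by auto
    moreover have "w \<noteq> x"
      using w by auto
    ultimately show ?thesis
      using w that(1) nbrs_sym[of b E x] by auto
  qed
  have xb: "x \<in> N b" and yb: "y \<in> N b"
    using outer[of a x] outer[of c y] x y xy by auto
  show ?thesis
  proof (cases "x = y")
    case False
    have "card {v, a, c, x, y} = 5"
      using False ne assms(2-4) x y xy by auto
    moreover have "card {v, a, c, x, y} \<le> degree E b"
      using va xb yb by (intro card_mono) auto
    ultimately show ?thesis
      by simp
  next
    case True
    show ?thesis
    proof (rule ccontr)
      assume "\<not> 5 \<le> degree E b"
      moreover have "card {v, a, c, x} = 4"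
        using ne assms(2-4) x xy by auto
      ultimately have b: "{v, a, c, x} = N b"
        using va xb by (intro card_seteq) auto
      have "x \<in> N a" "x \<in> V"
        using x N_subset[of a] by auto
      then have "card V \<le> card {v, b, c} + 2"
        by (intro closed_off_by_edge[OF \<open>x \<in> N a\<close>])
          (use v b[symmetric] y True inV ne assms(2-4) x xy in auto)
      then show False
        using order by (simp add: card_insert_if split: if_splits)
    qed
  qed
qed

section \<open>Discharging\<close>

text \<open>The charge sent to each neighbour, in multiples of \<open>1/6\<close>.\<close>

definition charge :: "'a \<Rightarrow> nat" where
  "charge u = (if 5 \<le> degree E u then 2 else if degree E u = 4 then 1 else 0)"

lemma charge_pos: "4 \<le> degree E u \<Longrightarrow> 1 \<le> charge u"
  by (simp add: charge_def)

lemma cubic_vertex_receives: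
  assumes "v \<in> V" and deg: "degree E v = 3"
  shows "2 \<le> (\<Sum>u\<in>N v. charge u)"
proof -
  obtain x y z where xyz: "N v = {x, y, z}" "x \<noteq> y" "x \<noteq> z" "y \<noteq> z"
    using deg by (auto simp: card_3_iff)
  have "\<exists>w\<in>{x, y, z}. w \<in> N u" if "u \<in> {x, y, z}" for u
    using triangle[of u v] that unfolding xyz(1) by blast
  from this[of x] this[of y] this[of z]
  have "(y \<in> N x \<or> z \<in> N x) \<and> (x \<in> N y \<or> z \<in> N y) \<and> (x \<in> N z \<or> y \<in> N z)"
    by simp
  moreover have "y \<in> N x \<longleftrightarrow> x \<in> N y" "z \<in> N x \<longleftrightarrow> x \<in> N z" "z \<in> N y \<longleftrightarrow> y \<in> N z"
    by (rule nbrs_sym[of _ E])+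
  ultimately consider "x \<in> N y" "x \<in> N z" | "y \<in> N x" "y \<in> N z" | "z \<in> N x" "z \<in> N y"
    by blast
  then obtain a b c where v: "N v = {a, b, c}" and ne: "a \<noteq> b" "a \<noteq> c" "b \<noteq> c"
    and ab: "b \<in> N a" and bc: "b \<in> N c"
  proof cases
    case 1
    then show ?thesis
      using xyz by (intro that[of y x z]) auto
  next
    case 2
    then show ?thesis
      using xyz by (intro that[of x y z]) auto
  next
    case 3
    then show ?thesis
      using xyz by (intro that[of x z y]) auto
  qed
  have inV: "a \<in> V" "b \<in> V" "c \<in> V"
    using v N_subset[of v] by auto
  have sum: "(\<Sum>u\<in>N v. charge u) = charge a + charge b + charge c"
    using v ne by simp
  consider "degree E b = 3" | "degree E b = 4" | "5 \<le> degree E b"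
    using degree_ge_3[OF inV(2)] by linarith
  then show ?thesis
  proof cases
    case 1
    have "{v, a, c} \<subseteq> N b"
      using v ab bc by (simp_all add: nbrs_sym[of v] nbrs_sym[of a E b] nbrs_sym[of c E b])
    moreover have "card {v, a, c} = 3"
      using v ne N_irrefl[of v] by auto
    ultimately have b: "N b = {v, a, c}"
      using 1 by (metis N_finite card_subset_eq)
    have "4 \<le> degree E a" "4 \<le> degree E c"
      using nbr_of_cubic_twins[of v a b c] nbr_of_cubic_twins[of v c b a] v b ne
      by (auto simp: insert_commute)
    then show ?thesis
      using charge_pos[of a] charge_pos[of c] sum by simp
  next
    case 2
    then have "degree E a \<noteq> 3 \<or> degree E c \<noteq> 3"
      using middle_nbr_of_cubic_path[OF v ne ab bc] by auto
    then have "4 \<le> degree E a \<or> 4 \<le> degree E c"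
      using degree_ge_3[OF inV(1)] degree_ge_3[OF inV(3)] by linarith
    then show ?thesis
      using charge_pos[of a] charge_pos[of b] charge_pos[of c] 2 sum by auto
  next
    case 3
    then show ?thesis
      using sum by (simp add: charge_def)
  qed
qed

lemma five_order_le_three_size: "5 * card V \<le> 3 * card E"
proof -
  have finV: "finite V"
    using graph by (simp add: simple_graph_def)
  \<comment> \<open>For degree 3 the missing \<open>2/6\<close> are what the vertex has to receive.\<close>
  have balance: "20 + degree E v * charge v \<le> 6 * degree E v + (if degree E v = 3 then 2 else 0)"
    if "v \<in> V" for v
    using degree_ge_3[OF that] by (auto simp: charge_def)
  have "(\<Sum>v\<in>V. degree E v * charge v) = (\<Sum>v\<in>V. \<Sum>u\<in>{u \<in> V. u \<in> N v}. charge v)"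
  proof (rule sum.cong)
    fix v
    have "{u \<in> V. u \<in> N v} = N v"
      using N_subset by auto
    then show "degree E v * charge v = (\<Sum>u\<in>{u \<in> V. u \<in> N v}. charge v)"
      by simp
  qed simp
  also have "\<dots> = (\<Sum>u\<in>V. \<Sum>v\<in>{v \<in> V. u \<in> N v}. charge v)"
    by (rule sum.swap_restrict[OF finV finV])
  also have "\<dots> = (\<Sum>u\<in>V. \<Sum>v\<in>N u. charge v)"
  proof (rule sum.cong)
    fix u
    have "{v \<in> V. u \<in> N v} = N u"
      using N_subset[of u] nbrs_sym[of u E] by auto
    then show "(\<Sum>v\<in>{v \<in> V. u \<in> N v}. charge v) = (\<Sum>v\<in>N u. charge v)"
      by simp
  qed simp
  finally have sent: "(\<Sum>v\<in>V. degree E v * charge v) = (\<Sum>u\<in>V. \<Sum>v\<in>N u. charge v)" .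
  have received: "(\<Sum>v\<in>V. if degree E v = 3 then 2 else 0) \<le> (\<Sum>u\<in>V. \<Sum>v\<in>N u. charge v)"
    using cubic_vertex_receives by (intro sum_mono) auto
  have "(\<Sum>v\<in>V. 20 + degree E v * charge v)
      \<le> (\<Sum>v\<in>V. 6 * degree E v + (if degree E v = 3 then 2 else 0))"
    using balance by (rule sum_mono)
  then have "20 * card V + (\<Sum>v\<in>V. degree E v * charge v)
      \<le> 6 * (\<Sum>v\<in>V. degree E v) + (\<Sum>v\<in>V. if degree E v = 3 then 2 else 0)"
    by (simp add: sum.distrib sum_distrib_left)
  then show ?thesis
    using sent received sum_degree_eq_twice_card_edges[OF graph] by linarith
qed

end

theorem theorem1p3:
  fixes V :: "'a set" and E :: "'a set set" and n :: nat
  assumes "simple_graph V E"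
    and "card V = n"
    and "n \<ge> 6"
    and "E \<noteq> {}"
    and "edge_proper 3 V E"
  shows "int (card E) \<ge> \<lceil>5 * real n / 3\<rceil>"
proof -
  interpret edge_proper_graph V E
    using assms by unfold_locales auto
  have "real (5 * n) \<le> real (3 * card E)"
    using five_order_le_three_size assms(2) by (intro of_nat_mono) simp
  then show ?thesis
    by (simp add: ceiling_le_iff)
qed

end
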